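(* Let $m_1,\ldots,m_s$ and $k_1,\ldots,k_t$ be positive integers, and put $\Lambda=\sum_{i=1}^{s}(m_i-1)$ and $\Sigma=\sum_{i=1}^{t}(k_i-1)$. If $\Sigma\le\lfloor(\Lambda+1)/2\rfloor$, then for all sufficiently large $n$ (i.e. for all $n>n_1(\Lambda)$, where $n_1(\Lambda)$ is a threshold depending only on $\Lambda$), $$R(C_n,K_{1,k_1},\ldots,K_{1,k_t},m_1K_2,\ldots,m_sK_2)=n+\Lambda.$$
   Context: All graphs are finite, simple and undirected. $C_n$ denotes the cycle on $n$ vertices, $K_{1,k}$ the star with $k$ edges, and $mK_2$ the disjoint union of $m$ edges (a matching of size $m$). For graphs $G_1,\ldots,G_k$, the multicolor Ramsey number $R(G_1,\ldots,G_k)$ is the smallest integer $n$ such that every coloring of the edges of the complete graph $K_n$ with $k$ colors contains a monochromatic copy of $G_i$ in color $i$ for some $1\le i\le k$ (a copy means a not necessarily induced subgraph). *)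

theory Defs
  imports "HOL-Library.Ramsey"
begin

type_synonym 'a ugraph = "'a set \<times> 'a set set"

abbreviation verts :: "'a ugraph \<Rightarrow> 'a set" where "verts \<equiv> fst"
abbreviation edges :: "'a ugraph \<Rightarrow> 'a set set" where "edges \<equiv> snd"

definition simple_graph :: "'a ugraph \<Rightarrow> bool" where
  "simple_graph G \<longleftrightarrow> finite (verts G) \<and> edges G \<subseteq> [verts G]\<^bsup>2\<^esup>"

definition complete_graph :: "nat \<Rightarrow> nat ugraph" where
  "complete_graph n = ({..<n}, [{..<n}]\<^bsup>2\<^esup>)"

text \<open>A cycle in the usual sense only for \<open>n \<ge> 3\<close>; for \<open>n = 1\<close> the set of edges degenerates
  to a loop, and for \<open>n = 2\<close> to a single edge.\<close>

definition cycle_graph :: "nat \<Rightarrow> nat ugraph" where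
  "cycle_graph n = ({..<n}, {{i, Suc i mod n} |i. i < n})"

definition star_graph :: "nat \<Rightarrow> nat ugraph" where
  "star_graph k = ({..k}, {{0, i} |i. 1 \<le> i \<and> i \<le> k})"

definition matching_graph :: "nat \<Rightarrow> nat ugraph" where
  "matching_graph m = ({..<2 * m}, {{2 * i, 2 * i + 1} |i. i < m})"

text \<open>Copies are not required to be induced.\<close>

definition contains_copy :: "'b ugraph \<Rightarrow> 'a ugraph \<Rightarrow> bool" where
  "contains_copy H G \<longleftrightarrow>
    (\<exists>f. inj_on f (verts G) \<and> f ` verts G \<subseteq> verts H \<and> (\<forall>e\<in>edges G. f ` e \<in> edges H))"

definition colour_class :: "'a ugraph \<Rightarrow> ('a set \<Rightarrow> nat) \<Rightarrow> nat \<Rightarrow> 'a ugraph" where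
  "colour_class H c i = (verts H, {e \<in> edges H. c e = i})"

text \<open>Colours are numbered from \<open>0\<close>, the positions in the list \<open>Gs\<close>.\<close>

definition ramsey_arrows :: "nat \<Rightarrow> nat ugraph list \<Rightarrow> bool" where
  "ramsey_arrows N Gs \<longleftrightarrow>
    (\<forall>c \<in> edges (complete_graph N) \<rightarrow> {..<length Gs}.
      \<exists>i<length Gs. contains_copy (colour_class (complete_graph N) c i) (Gs ! i))"

definition ramsey_number :: "nat ugraph list \<Rightarrow> nat" where
  "ramsey_number Gs = (LEAST N. ramsey_arrows N Gs)"

lemma simple_complete_graph: "simple_graph (complete_graph n)"
  by (simp add: simple_graph_def complete_graph_def)

lemma simple_cycle_graph: "n \<ge> 3 \<Longrightarrow> simple_graph (cycle_graph n)"
  by (auto simp: simple_graph_def cycle_graph_def mod_Suc doubleton_eq_iff split: if_splits)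

lemma simple_star_graph: "simple_graph (star_graph k)"
  by (auto simp: simple_graph_def star_graph_def)

lemma simple_matching_graph: "simple_graph (matching_graph m)"
  by (auto simp: simple_graph_def matching_graph_def)

text \<open>By Ramsey's theorem the minimum in the definition of \<open>ramsey_number\<close> exists.\<close>

lemma ramsey_arrows_exists:
  assumes "\<And>G. G \<in> set Gs \<Longrightarrow> simple_graph G"
  shows "\<exists>N. ramsey_arrows N Gs"
proof -
  let ?qs = "map (\<lambda>G. card (verts G)) Gs"
  obtain N :: nat where N: "partn_lst {..<N} ?qs 2"
    using ramsey_full by blast
  have "\<exists>i<length Gs. contains_copy (colour_class (complete_graph N) c i) (Gs ! i)"
    if c: "c \<in> [{..<N}]\<^bsup>2\<^esup> \<rightarrow> {..<length Gs}" for c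
  proof -
    from N c obtain i where i: "i < length Gs" and "monochromatic {..<N} (?qs ! i) 2 c i"
      unfolding partn_lst_def by auto
    then obtain H where H: "H \<in> [{..<N}]\<^bsup>card (verts (Gs ! i))\<^esup>" and mono: "c ` [H]\<^bsup>2\<^esup> \<subseteq> {i}"
      unfolding monochromatic_def by auto
    have sg: "finite (verts (Gs ! i))" "edges (Gs ! i) \<subseteq> [verts (Gs ! i)]\<^bsup>2\<^esup>"
      using assms i by (auto simp: simple_graph_def)
    have HN: "H \<subseteq> {..<N}" "finite H" "card H = card (verts (Gs ! i))"
      using H by (auto simp: nsets_def)
    then obtain f where f: "bij_betw f (verts (Gs ! i)) H"
      using sg(1) by (metis finite_same_card_bij)
    have fe: "f ` e \<in> [H]\<^bsup>2\<^esup>" if "e \<in> edges (Gs ! i)" for e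
    proof -
      have "e \<in> [verts (Gs ! i)]\<^bsup>2\<^esup>" using that sg(2) by blast
      then show ?thesis
        using f by (elim nsets2_E) (auto simp: bij_betw_def inj_on_def)
    qed
    have "contains_copy (colour_class (complete_graph N) c i) (Gs ! i)"
      unfolding contains_copy_def
    proof (intro exI[of _ f] conjI ballI)
      show "inj_on f (verts (Gs ! i))" using f by (simp add: bij_betw_def)
      show "f ` verts (Gs ! i) \<subseteq> verts (colour_class (complete_graph N) c i)"
        using f HN by (auto simp: bij_betw_def colour_class_def complete_graph_def)
      show "f ` e \<in> edges (colour_class (complete_graph N) c i)" if "e \<in> edges (Gs ! i)" for e
        using fe[OF that] mono nsets_mono[OF HN(1), of 2]
        by (auto simp: colour_class_def complete_graph_def)
    qed
    with i show ?thesis by blast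
  qed
  then show ?thesis
    by (intro exI[of _ N]) (simp add: ramsey_arrows_def complete_graph_def)
qed

end

theory Submission
  imports Defs
begin

text \<open>
  Write \<open>\<Lambda>\<close> and \<open>\<Sigma>\<close> for the sums of all \<open>m - 1\<close> and of all \<open>k - 1\<close>.

  Lower bound (\<open>not_ramsey_arrows\<close>): colour a complete graph on \<open>n - 1\<close> vertices with the cycle
  colour and add at most \<open>\<Lambda>\<close> further vertices, at most \<open>m - 1\<close> of them assigned to the matching
  \<open>m K\<^sub>2\<close>. An edge that is not inside the complete graph takes the colour of the matching to which its
  later endpoint is assigned. Then every edge in the
  colour of \<open>m K\<^sub>2\<close> meets a set of at most \<open>m - 1\<close> vertices, and the cycle colour lives on \<open>n - 1\<close>
  vertices.

  Upper bound (\<open>ramsey_arrows_cycle_stars_matchings\<close>): suppose that a colouring of the complete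
  graph on \<open>n + \<Lambda>\<close> vertices has none of the stars and none of the matchings. A matching in the
  union \<open>B\<close> of the matching colours has at most \<open>\<Lambda>\<close> edges, by the pigeonhole principle. So at most
  \<open>\<Lambda>\<close> vertices have more than \<open>2 \<Lambda>\<close> neighbours in \<open>B\<close>: from \<open>\<Lambda> + 1\<close> such vertices a greedy choice
  of neighbours would give a matching with \<open>\<Lambda> + 1\<close> edges. Delete these vertices. At least \<open>n\<close>
  vertices remain, and each of them is joined in the cycle colour to all but at most
  \<open>\<Sigma> + 2 \<Lambda>\<close> of the others, a number that does not grow with \<open>n\<close>. Such a dense graph has cycles of all
  large lengths (\<open>dense_graph_has_cycle\<close>), in particular of length \<open>n\<close>.

  The hypothesis on \<open>\<Sigma>\<close> serves to bound it by \<open>\<Lambda>\<close>, which makes the threshold depend on \<open>\<Lambda>\<close> alone.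
\<close>

section \<open>Copies of stars, matchings and cycles\<close>

lemma contains_star:
  assumes "v \<in> verts H" and "simple_graph H" and "k \<le> card {u. {v, u} \<in> edges H}"
  shows "contains_copy H (star_graph k)"
proof -
  let ?U = "{u. {v, u} \<in> edges H}"
  have U: "?U \<subseteq> verts H" "v \<notin> ?U" "finite ?U"
    using assms(2) by (auto simp: simple_graph_def nsets_def intro: finite_subset[of _ "verts H"])
  obtain T where T: "T \<subseteq> ?U" "card T = k" "finite T"
    using obtain_subset_with_card_n[OF assms(3)] by metis
  obtain g where g: "bij_betw g {1..k} T"
    using T finite_same_card_bij[of "{1..k}" T] by auto
  let ?f = "\<lambda>i. if i = 0 then v else g i"
  have gU: "g i \<in> ?U" if "1 \<le> i" "i \<le> k" for i
    using bij_betwE[OF g] T(1) that by (meson atLeastAtMost_iff subsetD)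
  have g_ne: "g i \<noteq> v" if "1 \<le> i" "i \<le> k" for i
    using gU[OF that] U(2) by metis
  have "inj_on ?f {..k}"
  proof (rule inj_onI)
    fix i j assume ij: "i \<in> {..k}" "j \<in> {..k}" "?f i = ?f j"
    show "i = j"
    proof (cases "i = 0 \<or> j = 0")
      case True
      then show ?thesis
        using ij g_ne[of i] g_ne[of j] by (auto split: if_splits)
    next
      case False
      then show ?thesis
        using ij inj_onD[OF bij_betw_imp_inj_on[OF g], of i j] by simp
    qed
  qed
  moreover have "?f ` {..k} \<subseteq> verts H"
  proof
    fix x assume "x \<in> ?f ` {..k}"
    then obtain i where "i \<le> k" "x = ?f i" by blast
    then show "x \<in> verts H"
      using gU[of i] U(1) assms(1) by (cases "i = 0") auto
  qed
  moreover have "?f ` {0, i} \<in> edges H" if "1 \<le> i" "i \<le> k" for i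
    using gU[OF that] that by (simp add: insert_commute)
  ultimately show ?thesis
    unfolding contains_copy_def star_graph_def by (intro exI[of _ ?f] conjI) (simp, simp, fastforce)
qed

lemma contains_matching:
  assumes "simple_graph H" and "M \<subseteq> edges H" and "pairwise disjnt M" and "m \<le> card M"
  shows "contains_copy H (matching_graph m)"
proof -
  obtain T where T: "T \<subseteq> M" "card T = m" "finite T"
    using obtain_subset_with_card_n[OF assms(4)] by metis
  obtain g where g: "bij_betw g {..<m} T"
    using T finite_same_card_bij[of "{..<m}" T] by auto
  have gM: "g i \<in> M" if "i < m" for i
    using bij_betwE[OF g] T(1) that by (meson lessThan_iff subsetD)
  have "\<exists>a b. g i = {a, b} \<and> a \<noteq> b" if "i < m" for i
  proof -
    have "g i \<in> [verts H]\<^bsup>2\<^esup>"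
      using gM[OF that] assms(1,2) unfolding simple_graph_def by blast
    then show ?thesis by (elim nsets2_E) blast
  qed
  then obtain a b where ab: "\<And>i. i < m \<Longrightarrow> g i = {a i, b i} \<and> a i \<noteq> b i"
    by metis
  let ?f = "\<lambda>j. if even j then a (j div 2) else b (j div 2)"
  have f_in: "?f j \<in> g (j div 2)" if "j < 2 * m" for j
    using that ab[of "j div 2"] by auto
  have disj: "i = j" if "i < m" "j < m" "x \<in> g i" "x \<in> g j" for i j x
  proof (rule ccontr)
    assume "i \<noteq> j"
    then have "g i \<noteq> g j"
      using g that by (auto simp: bij_betw_def inj_on_def)
    then have "disjnt (g i) (g j)"
      using assms(3) gM that by (auto simp: pairwise_def)
    then show False using that by (auto simp: disjnt_def)
  qed
  have "inj_on ?f {..<2 * m}"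
  proof (rule inj_onI)
    fix i j assume ij: "i \<in> {..<2 * m}" "j \<in> {..<2 * m}" and eq: "?f i = ?f j"
    have d: "i div 2 = j div 2"
      using disj[of "i div 2" "j div 2" "?f i"] f_in[of i] f_in[of j] ij eq by auto
    have "even i = even j"
      using eq d ab[of "i div 2"] ij by (auto split: if_splits)
    then show "i = j"
      using d by (metis bit_eq_rec)
  qed
  moreover have "?f ` {..<2 * m} \<subseteq> verts H"
  proof
    fix x assume "x \<in> ?f ` {..<2 * m}"
    then obtain j where "j < 2 * m" "x \<in> g (j div 2)"
      using f_in by blast
    moreover have "g (j div 2) \<in> edges H"
      using gM[of "j div 2"] assms(2) \<open>j < 2 * m\<close> by auto
    ultimately show "x \<in> verts H"
      using assms(1) by (auto simp: simple_graph_def nsets_def)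
  qed
  moreover have "?f ` {2 * i, 2 * i + 1} \<in> edges H" if "i < m" for i
    using ab[OF that] gM[OF that] assms(2) by (auto simp: insert_commute)
  ultimately show ?thesis
    unfolding contains_copy_def matching_graph_def by (intro exI[of _ ?f]) auto
qed

definition is_cycle :: "('a \<Rightarrow> 'a \<Rightarrow> bool) \<Rightarrow> 'a list \<Rightarrow> bool" where
  "is_cycle adj xs \<longleftrightarrow>
    distinct xs \<and> (\<forall>i<length xs. adj (xs ! i) (xs ! (Suc i mod length xs)))"

lemma contains_cycle:
  assumes "is_cycle (\<lambda>u v. {u, v} \<in> edges H) xs" and "set xs \<subseteq> verts H"
  shows "contains_copy H (cycle_graph (length xs))"
proof -
  have "inj_on ((!) xs) {..<length xs}"
    using assms(1) by (simp add: is_cycle_def inj_on_nth)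
  moreover have "(!) xs ` {..<length xs} \<subseteq> verts H"
    using assms(2) by auto
  moreover have "(!) xs ` {i, Suc i mod length xs} \<in> edges H" if "i < length xs" for i
    using assms(1) that by (simp add: is_cycle_def)
  ultimately show ?thesis
    unfolding contains_copy_def cycle_graph_def by (intro exI[of _ "(!) xs"]) auto
qed

section \<open>Cycles in dense graphs\<close>

text \<open>Here \<open>d\<close> bounds the number of non-neighbours of a vertex, the vertex itself included. The next
  vertex of the clique is any vertex that is not among the non-neighbours of the earlier ones; it
  differs from them because no vertex is its own neighbour.\<close>

lemma dense_graph_has_clique:
  fixes V :: "'a set"
  assumes "finite V" and "\<And>v. v \<in> V \<Longrightarrow> card {u \<in> V. \<not> adj v u} \<le> d"
    and "\<And>v. \<not> adj v v" and "q * d < card V"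
  shows "\<exists>xs. length xs = Suc q \<and> set xs \<subseteq> V \<and> distinct xs \<and>
    (\<forall>i<length xs. \<forall>j<i. adj (xs ! j) (xs ! i))"
  using assms(4)
proof (induction q)
  case 0
  then obtain v where "v \<in> V" by (auto simp: card_gt_0_iff)
  then show ?case by (intro exI[of _ "[v]"]) auto
next
  case (Suc q)
  then obtain xs where xs: "length xs = Suc q" "set xs \<subseteq> V" "distinct xs"
    "\<forall>i<length xs. \<forall>j<i. adj (xs ! j) (xs ! i)"
    by auto
  let ?bad = "\<Union>x\<in>set xs. {u \<in> V. \<not> adj x u}"
  have "card ?bad \<le> (\<Sum>x\<in>set xs. card {u \<in> V. \<not> adj x u})"
    by (rule card_UN_le) simp
  also have "\<dots> \<le> card (set xs) * d"
    using assms(2) xs(2) sum_bounded_above[of "set xs" _ d] by (metis (no_types, lifting) of_nat_id subsetD)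
  also have "\<dots> < card V"
    using Suc.prems xs by (simp add: distinct_card)
  finally have "card ?bad < card V" .
  moreover have "finite ?bad" using assms(1) by simp
  ultimately have "\<not> V \<subseteq> ?bad"
    by (meson card_mono not_le)
  then obtain v where v: "v \<in> V" "\<And>x. x \<in> set xs \<Longrightarrow> adj x v"
    by blast
  then have "v \<notin> set xs"
    using assms(3) by blast
  then show ?case
    using xs v by (intro exI[of _ "xs @ [v]"]) (auto simp: nth_append less_Suc_eq)
qed

text \<open>If no two cyclically consecutive vertices were neighbours of \<open>v\<close>, then every position of the
  cycle would hold a non-neighbour or precede one, and the cycle would have at most \<open>2 d\<close>
  vertices.\<close>

lemma cycle_insert_vertex:
  assumes "finite V" and cyc: "is_cycle adj xs" and xsV: "set xs \<subseteq> V"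
    and v: "v \<in> V" "v \<notin> set xs" and sym: "\<And>u w. adj u w \<Longrightarrow> adj w u"
    and d: "card {u \<in> V. \<not> adj v u} \<le> d" and len: "2 * d < length xs"
  shows "\<exists>ys. is_cycle adj ys \<and> set ys \<subseteq> V \<and> length ys = Suc (length xs)"
proof -
  let ?l = "length xs"
  let ?\<sigma> = "\<lambda>i. Suc i mod ?l"
  let ?B = "{i. i < ?l \<and> \<not> adj v (xs ! i)}"
  let ?B' = "{i. i < ?l \<and> \<not> adj v (xs ! ?\<sigma> i)}"
  have dist: "distinct xs" and adj: "\<And>i. i < ?l \<Longrightarrow> adj (xs ! i) (xs ! ?\<sigma> i)"
    using cyc by (auto simp: is_cycle_def)
  have cB: "card ?B \<le> d"
  proof -
    have "card ?B \<le> card {u \<in> V. \<not> adj v u}"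
    proof (rule card_inj_on_le)
      show "inj_on ((!) xs) ?B" using dist by (auto simp: inj_on_def nth_eq_iff_index_eq)
      show "(!) xs ` ?B \<subseteq> {u \<in> V. \<not> adj v u}" using xsV by auto
    qed (use assms(1) in auto)
    then show ?thesis using d by linarith
  qed
  have "card ?B' \<le> card ?B"
  proof (rule card_inj_on_le)
    show "inj_on ?\<sigma> ?B'"
      by (auto simp: inj_on_def mod_Suc split: if_splits)
    show "?\<sigma> ` ?B' \<subseteq> ?B" by (auto intro!: mod_less_divisor)
  qed simp
  then have "card (?B \<union> ?B') < ?l"
    using cB len card_Un_le[of ?B ?B'] by linarith
  then have "\<not> {..<?l} \<subseteq> ?B \<union> ?B'"
    using card_mono[of "?B \<union> ?B'" "{..<?l}"] by auto
  then obtain i where i: "i < ?l" "adj v (xs ! i)" "adj v (xs ! ?\<sigma> i)"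
    by auto
  \<comment> \<open>Rotate the cycle so that the chosen consecutive pair becomes its last and its first vertex.\<close>
  define zs where "zs = rotate (Suc i) xs"
  have lz: "length zs = ?l" and sz: "set zs = set xs" and dz: "distinct zs"
    using dist by (auto simp: zs_def)
  have nz: "zs ! j = xs ! ((Suc i + j) mod ?l)" if "j < ?l" for j
    using that by (simp add: zs_def nth_rotate del: rotate_Suc)
  have first: "zs ! 0 = xs ! ?\<sigma> i"
    using nz[of 0] i(1) by (cases xs) auto
  have last: "zs ! (?l - 1) = xs ! i"
  proof -
    have "Suc i + (?l - 1) = i + ?l" using i(1) by simp
    then have "(Suc i + (?l - 1)) mod ?l = i" using i(1) by (metis mod_add_self2 mod_less)
    then show ?thesis using nz[of "?l - 1"] i(1) by simp
  qed
  have inner: "adj (zs ! j) (zs ! Suc j)" if "Suc j < ?l" for j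
  proof -
    have "(Suc i + j) mod ?l < ?l" using that by (intro mod_less_divisor) linarith
    then show ?thesis
      using nz[of j] nz[of "Suc j"] that adj[of "(Suc i + j) mod ?l"] by (simp add: mod_Suc_eq)
  qed
  have "is_cycle adj (zs @ [v])"
    unfolding is_cycle_def
  proof (intro conjI allI impI)
    show "distinct (zs @ [v])" using dz sz v(2) by simp
    fix j assume "j < length (zs @ [v])"
    then consider "Suc j < ?l" | "Suc j = ?l" | "j = ?l"
      using lz by fastforce
    then show "adj ((zs @ [v]) ! j) ((zs @ [v]) ! (Suc j mod length (zs @ [v])))"
    proof cases
      case 1
      then show ?thesis using inner lz by (simp add: nth_append)
    next
      case 2
      then have "j = ?l - 1" by simp
      then show ?thesis using 2 last sym[OF i(2)] lz by (simp add: nth_append)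
    next
      case 3
      then show ?thesis using first i lz by (auto simp: nth_append)
    qed
  qed
  then show ?thesis
    using v(1) xsV sz lz by (intro exI[of _ "zs @ [v]"]) auto
qed

text \<open>A clique on \<open>2 d + 1\<close> vertices contains a cycle that is long enough for further vertices to be
  inserted one at a time.\<close>

lemma dense_graph_has_cycle:
  assumes "finite V" and "\<And>v. v \<in> V \<Longrightarrow> card {u \<in> V. \<not> adj v u} \<le> d"
    and irrefl: "\<And>v. \<not> adj v v" and sym: "\<And>u w. adj u w \<Longrightarrow> adj w u"
    and "2 * d * d < card V" and "d \<ge> 1" and "2 * d < n" and "n \<le> card V"
  shows "\<exists>xs. is_cycle adj xs \<and> set xs \<subseteq> V \<and> length xs = n"
proof -
  have "Suc (2 * d) \<le> n" using assms by simp
  then show ?thesis using \<open>n \<le> card V\<close>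
  proof (induction n rule: dec_induct)
    case base
    obtain xs where xs: "length xs = Suc (2 * d)" "set xs \<subseteq> V" "distinct xs"
      "\<forall>i<length xs. \<forall>j<i. adj (xs ! j) (xs ! i)"
      using dense_graph_has_clique[OF assms(1-3,5)] by auto
    have "adj (xs ! i) (xs ! (Suc i mod length xs))" if i: "i < length xs" for i
    proof (cases "Suc i = length xs")
      case True
      then have "0 < i" using xs(1) \<open>d \<ge> 1\<close> by simp
      then show ?thesis using True xs(4) i sym by simp
    next
      case False
      then show ?thesis using xs(4) i by simp
    qed
    then show ?case using xs by (auto simp: is_cycle_def)
  next
    case (step n)
    then obtain xs where xs: "is_cycle adj xs" "set xs \<subseteq> V" "length xs = n"
      by auto
    then have "card (set xs) < card V"
      using step.prems by (simp add: is_cycle_def distinct_card)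
    then obtain v where "v \<in> V" "v \<notin> set xs"
      using card_mono[of "set xs" V] by fastforce
    then show ?case
      using cycle_insert_vertex[OF assms(1) xs(1,2) _ _ sym assms(2), of v] xs(3) step.hyps by auto
  qed
qed

section \<open>Vertices of large degree and matchings\<close>

lemma greedy_distinct_representatives:
  assumes "finite S" and "\<And>v. v \<in> S \<Longrightarrow> card S \<le> card (A v)"
  shows "\<exists>g. inj_on g S \<and> (\<forall>v\<in>S. g v \<in> A v)"
  using assms
proof (induction S rule: finite_induct)
  case empty
  then show ?case by simp
next
  case (insert x S)
  have "card S \<le> card (A v)" if "v \<in> S" for v
    using insert.prems[of v] insert.hyps that by simp
  then obtain g where g: "inj_on g S" "\<forall>v\<in>S. g v \<in> A v"
    using insert.IH by blast
  have "card (g ` S) < card (A x)"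
    using insert.prems[of x] insert.hyps card_image_le[of S g] by simp
  then obtain y where y: "y \<in> A x" "y \<notin> g ` S"
    using card_mono[of "g ` S" "A x"] insert.hyps(1) by fastforce
  have "inj_on (g(x := y)) (insert x S)"
    using g(1) y(2) insert.hyps(2) by (auto simp: inj_on_def)
  moreover have "\<forall>v\<in>insert x S. (g(x := y)) v \<in> A v"
    using g(2) y(1) insert.hyps(2) by auto
  ultimately show ?case by blast
qed

text \<open>Each vertex of \<open>S\<close> still has \<open>card S\<close> neighbours outside \<open>S\<close>, so distinct partners outside
  \<open>S\<close> can be chosen for all of them.\<close>

lemma large_degrees_give_matching:
  assumes "finite S" and "\<And>v. {v} \<notin> E" and "\<And>v. v \<in> S \<Longrightarrow> 2 * card S \<le> Suc (card {u. {v, u} \<in> E})"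
  shows "\<exists>M \<subseteq> E. pairwise disjnt M \<and> card M = card S"
proof -
  have outside: "card S \<le> card ({u. {v, u} \<in> E} - S)" if v: "v \<in> S" for v
  proof -
    let ?N = "{u. {v, u} \<in> E}"
    have "?N - S = ?N - (S - {v})"
      using assms(2)[of v] by auto
    moreover have "card ?N - card (S - {v}) \<le> card (?N - (S - {v}))"
      using assms(1) by (intro diff_card_le_card_Diff) simp
    moreover have "card (S - {v}) = card S - 1" "card S > 0"
      using assms(1) v by (auto simp: card_gt_0_iff)
    ultimately show ?thesis
      using assms(3)[OF v] by simp
  qed
  obtain g where g: "inj_on g S" "\<And>v. v \<in> S \<Longrightarrow> {v, g v} \<in> E \<and> g v \<notin> S"
    using greedy_distinct_representatives[of S "\<lambda>v. {u. {v, u} \<in> E} - S", OF assms(1) outside]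
    by auto
  let ?M = "(\<lambda>v. {v, g v}) ` S"
  have "inj_on (\<lambda>v. {v, g v}) S"
    using g by (auto simp: inj_on_def doubleton_eq_iff)
  then have "card ?M = card S" by (rule card_image)
  moreover have "pairwise disjnt ?M"
    using g by (auto simp: pairwise_def disjnt_def inj_on_def)
  moreover have "?M \<subseteq> E" using g by auto
  ultimately show ?thesis by blast
qed

section \<open>The upper bound\<close>

text \<open>The pigeonhole principle in the form needed for consecutive colours \<open>a, a + 1, \<dots>\<close>: for the star
  colours it bounds a degree, for the matching colours the size of a matching.\<close>

lemma card_le_sum_of_fibres:
  fixes A :: "'a set" and f :: "'a \<Rightarrow> nat"
  assumes "\<And>x. x \<in> A \<Longrightarrow> a \<le> f x \<and> f x < a + length ks"
    and "\<And>i. i < length ks \<Longrightarrow> card {x \<in> A. f x = a + i} \<le> ks ! i - 1"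
  shows "card A \<le> (\<Sum>k\<leftarrow>ks. k - 1)"
proof -
  have "A = (\<Union>i<length ks. {x \<in> A. f x = a + i})"
  proof (intro equalityI subsetI)
    fix x assume "x \<in> A"
    then show "x \<in> (\<Union>i<length ks. {x \<in> A. f x = a + i})"
      using assms(1)[of x] by (auto intro!: bexI[of _ "f x - a"])
  qed auto
  then have "card A \<le> (\<Sum>i<length ks. card {x \<in> A. f x = a + i})"
    using card_UN_le[of "{..<length ks}" "\<lambda>i. {x \<in> A. f x = a + i}"] by simp
  also have "\<dots> \<le> (\<Sum>i<length ks. ks ! i - 1)"
    using assms(2) by (intro sum_mono) simp
  also have "\<dots> = (\<Sum>k\<leftarrow>ks. k - 1)"
    by (simp add: sum_list_sum_nth atLeast0LessThan)
  finally show ?thesis .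
qed

lemma simple_colour_class: "simple_graph H \<Longrightarrow> simple_graph (colour_class H c i)"
  by (auto simp: simple_graph_def colour_class_def)

text \<open>After the deletion of the vertices of large degree in the matching colours, a vertex has at most
  \<open>1 + \<Sigma> + 2 \<Lambda>\<close> non-neighbours in the cycle colour: itself, its neighbours in the star colours
  and those in the matching colours. The bound on \<open>n\<close> is what \<open>dense_graph_has_cycle\<close> asks for this
  number of non-neighbours.\<close>

lemma ramsey_arrows_cycle_stars_matchings:
  fixes ms ks :: "nat list" and n :: nat
  defines "\<Lambda> \<equiv> (\<Sum>m\<leftarrow>ms. m - 1)" and "\<Sigma> \<equiv> (\<Sum>k\<leftarrow>ks. k - 1)"
  assumes large: "2 * (1 + \<Sigma> + 2 * \<Lambda>) * (1 + \<Sigma> + 2 * \<Lambda>) < n"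
  shows "ramsey_arrows (n + \<Lambda>) (cycle_graph n # map star_graph ks @ map matching_graph ms)"
  unfolding ramsey_arrows_def
proof
  let ?Gs = "cycle_graph n # map star_graph ks @ map matching_graph ms"
  let ?K = "complete_graph (n + \<Lambda>)"
  let ?t = "length ks"
  fix c assume c: "c \<in> edges ?K \<rightarrow> {..<length ?Gs}"
  define V where "V = {..<n + \<Lambda>}"
  define d where "d = 1 + \<Sigma> + 2 * \<Lambda>"
  have VK: "verts ?K = V"
    by (simp add: V_def complete_graph_def)
  have edge: "{u, v} \<in> edges ?K \<longleftrightarrow> u \<in> V \<and> v \<in> V \<and> u \<noteq> v" for u v
    by (auto simp: V_def complete_graph_def nsets_def card_2_iff doubleton_eq_iff)
  have simple: "simple_graph (colour_class ?K c i)" for i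
    by (intro simple_colour_class simple_complete_graph)
  show "\<exists>i<length ?Gs. contains_copy (colour_class ?K c i) (?Gs ! i)"
  proof (rule ccontr)
    assume none: "\<not> ?thesis"
    have no_star: "\<not> contains_copy (colour_class ?K c (1 + j)) (star_graph (ks ! j))"
      if "j < ?t" for j
      using none[simplified, THEN spec[of _ "1 + j"]] that by (simp add: nth_append)
    have no_matching: "\<not> contains_copy (colour_class ?K c (1 + ?t + i)) (matching_graph (ms ! i))"
      if "i < length ms" for i
      using none[simplified, THEN spec[of _ "1 + ?t + i"]] that by (simp add: nth_append)
    define star_nbrs where "star_nbrs v = {u. {v, u} \<in> edges ?K \<and> 1 \<le> c {v, u} \<and> c {v, u} < 1 + ?t}" for v
    have star_degree: "card (star_nbrs v) \<le> \<Sigma>" if "v \<in> V" for v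
      unfolding \<Sigma>_def
    proof (rule card_le_sum_of_fibres[where f = "\<lambda>u. c {v, u}" and a = 1])
      fix j assume j: "j < ?t"
      have "\<not> ks ! j \<le> card {u. {v, u} \<in> edges (colour_class ?K c (1 + j))}"
        using contains_star[OF _ simple] no_star[OF j] that VK by (auto simp: colour_class_def)
      moreover have "{u \<in> star_nbrs v. c {v, u} = 1 + j} = {u. {v, u} \<in> edges (colour_class ?K c (1 + j))}"
        using j by (auto simp: star_nbrs_def colour_class_def)
      ultimately show "card {u \<in> star_nbrs v. c {v, u} = 1 + j} \<le> ks ! j - 1"
        by simp
    qed (auto simp: star_nbrs_def)
    define B where "B = {e \<in> edges ?K. 1 + ?t \<le> c e}"
    have matching_le: "card M \<le> \<Lambda>" if M: "M \<subseteq> B" "pairwise disjnt M" for M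
      unfolding \<Lambda>_def
    proof (rule card_le_sum_of_fibres[where f = c and a = "1 + ?t"])
      show "1 + ?t \<le> c e \<and> c e < 1 + ?t + length ms" if "e \<in> M" for e
        using that M c by (auto simp: B_def)
      fix i assume i: "i < length ms"
      have "\<not> ms ! i \<le> card {e \<in> M. c e = 1 + ?t + i}"
      proof
        assume le: "ms ! i \<le> card {e \<in> M. c e = 1 + ?t + i}"
        have "{e \<in> M. c e = 1 + ?t + i} \<subseteq> edges (colour_class ?K c (1 + ?t + i))"
          using M by (auto simp: B_def colour_class_def)
        moreover have "pairwise disjnt {e \<in> M. c e = 1 + ?t + i}"
          using M(2) by (rule pairwise_subset) auto
        ultimately show False
          using contains_matching[OF simple _ _ le] no_matching[OF i] by blast
      qed
      then show "card {e \<in> M. c e = 1 + ?t + i} \<le> ms ! i - 1" by simp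
    qed
    define S where "S = {v \<in> V. 2 * \<Lambda> < card {u. {v, u} \<in> B}}"
    have "card S \<le> \<Lambda>"
    proof (rule ccontr)
      assume "\<not> card S \<le> \<Lambda>"
      then have "Suc \<Lambda> \<le> card S" by simp
      then obtain T where T: "T \<subseteq> S" "card T = Suc \<Lambda>" "finite T"
        using obtain_subset_with_card_n[of "Suc \<Lambda>" S] by metis
      have "\<And>v. {v} \<notin> B"
        using edge by (metis (no_types, lifting) B_def insert_absorb2 mem_Collect_eq)
      moreover have "2 * card T \<le> Suc (card {u. {v, u} \<in> B})" if "v \<in> T" for v
        using that T by (auto simp: S_def)
      ultimately obtain M where "M \<subseteq> B" "pairwise disjnt M" "card M = card T"
        using large_degrees_give_matching[OF T(3)] by blast
      then show False using matching_le[of M] T(2) by simp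
    qed
    define W where "W = V - S"
    have W: "finite W" "n \<le> card W"
      using diff_card_le_card_Diff[of S V] \<open>card S \<le> \<Lambda>\<close> by (auto simp: W_def V_def S_def)
    let ?adj = "\<lambda>u v. {u, v} \<in> edges (colour_class ?K c 0)"
    have codegree: "card {u \<in> W. \<not> ?adj v u} \<le> d" if v: "v \<in> W" for v
    proof -
      have "{u \<in> W. \<not> ?adj v u} \<subseteq> {v} \<union> star_nbrs v \<union> {u. {v, u} \<in> B}"
        using v edge by (auto simp: W_def star_nbrs_def B_def colour_class_def)
      moreover have "finite (star_nbrs v)" "finite {u. {v, u} \<in> B}"
        using edge by (auto simp: star_nbrs_def B_def V_def intro: finite_subset[of _ "{..<n + \<Lambda>}"])
      ultimately have "card {u \<in> W. \<not> ?adj v u} \<le> card ({v} \<union> star_nbrs v \<union> {u. {v, u} \<in> B})"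
        by (intro card_mono) auto
      also have "\<dots> \<le> card {v} + card (star_nbrs v) + card {u. {v, u} \<in> B}"
        by (meson add_le_mono1 card_Un_le order_trans)
      also have "\<dots> \<le> d"
        using star_degree[of v] v by (auto simp: W_def S_def d_def)
      finally show ?thesis .
    qed
    have d: "2 * d * d < n" "d \<ge> 1"
      using large by (auto simp: d_def)
    then have "2 * d < n"
      by (metis le_trans mult.right_neutral mult_le_mono2 not_le)
    moreover have "\<And>v. \<not> ?adj v v"
      unfolding colour_class_def snd_conv mem_Collect_eq edge by simp
    moreover have "\<And>u v. ?adj u v \<Longrightarrow> ?adj v u"
      by (simp add: insert_commute)
    ultimately obtain xs where xs: "is_cycle ?adj xs" "set xs \<subseteq> W" "length xs = n"
      using dense_graph_has_cycle[of W ?adj d n, OF W(1) codegree] d W(2) by force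
    have "contains_copy (colour_class ?K c 0) (cycle_graph n)"
      using contains_cycle[OF xs(1)] xs(2,3) VK by (auto simp: colour_class_def W_def)
    then show False
      using none[simplified, THEN spec[of _ 0]] by simp
  qed
qed

section \<open>The lower bound\<close>

text \<open>This assigns the vertices outside the complete graph of the extremal colouring to the
  matchings.\<close>

lemma exists_map_with_bounded_fibres:
  "\<exists>p. (\<forall>x<(\<Sum>m\<leftarrow>ms. m - 1). p x < length ms) \<and>
    (\<forall>i<length ms. card {x. x < (\<Sum>m\<leftarrow>ms. m - 1) \<and> p x = i} \<le> ms ! i - (1 :: nat))"
proof -
  let ?L = "\<Sum>m\<leftarrow>ms. m - 1"
  \<comment> \<open>Enumerate the pairs that consist of a class and a position in it; the class of a number is the
    first component of its pair.\<close>
  let ?P = "SIGMA i:{..<length ms}. {..<ms ! i - 1}"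
  have "card ?P = ?L"
    by (simp add: sum_list_sum_nth atLeast0LessThan)
  then obtain h where h: "bij_betw h {..<?L} ?P"
    using finite_same_card_bij[of "{..<?L}" ?P] by auto
  have "fst (h x) < length ms" if "x < ?L" for x
    using bspec[OF bij_betwE[OF h], of x] that by auto
  moreover have "card {x. x < ?L \<and> fst (h x) = i} \<le> ms ! i - 1" for i
  proof -
    have "card {x. x < ?L \<and> fst (h x) = i} \<le> card ({i} \<times> {..<ms ! i - 1})"
    proof (rule card_inj_on_le)
      show "inj_on h {x. x < ?L \<and> fst (h x) = i}"
        using h by (auto simp: bij_betw_def inj_on_def)
      show "h ` {x. x < ?L \<and> fst (h x) = i} \<subseteq> {i} \<times> {..<ms ! i - 1}"
        using bij_betwE[OF h] by force
    qed simp
    then show ?thesis by simp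
  qed
  ultimately show ?thesis
    by (intro exI[of _ "\<lambda>x. fst (h x)"]) auto
qed

text \<open>The edges of a matching meet a vertex cover in distinct vertices.\<close>

lemma matching_cover_bound:
  assumes "contains_copy H (matching_graph m)" and "finite A" and "\<And>e. e \<in> edges H \<Longrightarrow> e \<inter> A \<noteq> {}"
  shows "m \<le> card A"
proof -
  obtain f where f: "inj_on f {..<2 * m}"
    and f_edges: "\<forall>e\<in>edges (matching_graph m). f ` e \<in> edges H"
    using assms(1) by (auto simp: contains_copy_def matching_graph_def)
  have f_edge: "f ` {2 * i, 2 * i + 1} \<in> edges H" if "i < m" for i
    by (rule bspec[OF f_edges]) (use that in \<open>auto simp: matching_graph_def\<close>)
  have "\<forall>i. \<exists>j. i < m \<longrightarrow> (j = 2 * i \<or> j = 2 * i + 1) \<and> f j \<in> A"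
    using assms(3)[OF f_edge] by blast
  then obtain g where g: "\<And>i. i < m \<Longrightarrow> (g i = 2 * i \<or> g i = 2 * i + 1) \<and> f (g i) \<in> A"
    by metis
  have "inj_on (f \<circ> g) {..<m}"
  proof (rule inj_onI)
    fix i j assume ij: "i \<in> {..<m}" "j \<in> {..<m}" "(f \<circ> g) i = (f \<circ> g) j"
    then have "g i < 2 * m" "g j < 2 * m"
      using g[of i] g[of j] by auto
    then have "g i = g j"
      using ij f by (auto simp: inj_on_def)
    moreover have "g i div 2 = i" "g j div 2 = j"
      using g[of i] g[of j] ij(1,2) by auto
    ultimately show "i = j" by metis
  qed
  then have "card {..<m} \<le> card A"
    using g assms(2) by (intro card_inj_on_le[of "f \<circ> g"]) auto
  then show ?thesis by simp
qed

text \<open>The vertices below \<open>n - 1\<close> form the complete graph in the cycle colour, so the greatest vertex of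
  an edge tells whether the edge leaves it and determines the colour. Every vertex of a cycle lies
  on an edge of the cycle, which keeps a cycle in colour \<open>0\<close> below \<open>n - 1\<close>.\<close>

lemma not_ramsey_arrows:
  fixes ms ks :: "nat list" and n N :: nat
  assumes ms: "\<forall>m\<in>set ms. m \<ge> 1" and ks: "\<forall>k\<in>set ks. k \<ge> 1" and n: "n \<ge> 1"
    and N: "N < n + (\<Sum>m\<leftarrow>ms. m - 1)"
  shows "\<not> ramsey_arrows N (cycle_graph n # map star_graph ks @ map matching_graph ms)"
proof
  let ?Gs = "cycle_graph n # map star_graph ks @ map matching_graph ms"
  let ?L = "\<Sum>m\<leftarrow>ms. m - 1"
  let ?K = "complete_graph N"
  let ?t = "length ks"
  assume arrows: "ramsey_arrows N ?Gs"
  obtain p where p: "\<And>x. x < ?L \<Longrightarrow> p x < length ms"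
    "\<And>i. i < length ms \<Longrightarrow> card {x. x < ?L \<and> p x = i} \<le> ms ! i - 1"
    using exists_map_with_bounded_fibres[of ms] by auto
  define c where "c e = (if Max e < n - 1 then 0 else 1 + ?t + p (Max e - (n - 1)))" for e :: "nat set"
  have Max: "Max e \<in> e \<and> (\<forall>v\<in>e. v \<le> Max e) \<and> Max e < N" if "e \<in> edges ?K" for e
  proof -
    have "finite e" "e \<noteq> {}" "e \<subseteq> {..<N}"
      using that by (auto simp: complete_graph_def nsets_def)
    then show ?thesis using Max_in[of e] by auto
  qed
  have "c e < length ?Gs" if "e \<in> edges ?K" for e
    using p(1)[of "Max e - (n - 1)"] Max[OF that] N n by (auto simp: c_def)
  then obtain i where i: "i < length ?Gs" and copy: "contains_copy (colour_class ?K c i) (?Gs ! i)"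
    using arrows unfolding ramsey_arrows_def by blast
  consider "i = 0" | j where "j < ?t" "i = 1 + j" | j where "j < length ms" "i = 1 + ?t + j"
  proof -
    have "i = 0 \<or> (i - 1 < ?t \<and> i = 1 + (i - 1)) \<or> (i - 1 - ?t < length ms \<and> i = 1 + ?t + (i - 1 - ?t))"
      using i by auto
    then show ?thesis using that by blast
  qed
  then show False
  proof cases
    case 1
    then obtain f where f: "inj_on f {..<n}"
      and f_edges: "\<forall>e\<in>edges (cycle_graph n). f ` e \<in> edges (colour_class ?K c 0)"
      using copy by (auto simp: contains_copy_def cycle_graph_def)
    have f_edge: "f ` {i, Suc i mod n} \<in> edges (colour_class ?K c 0)" if "i < n" for i
      by (rule bspec[OF f_edges]) (use that in \<open>auto simp: cycle_graph_def\<close>)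
    have "f i < n - 1" if "i < n" for i
    proof -
      have "f ` {i, Suc i mod n} \<in> edges ?K" "c (f ` {i, Suc i mod n}) = 0"
        using f_edge[OF that] by (auto simp: colour_class_def)
      then have "f i \<le> Max (f ` {i, Suc i mod n})" "Max (f ` {i, Suc i mod n}) < n - 1"
        using Max[of "f ` {i, Suc i mod n}"] by (auto simp: c_def split: if_splits)
      then show ?thesis by linarith
    qed
    then have "card {..<n} \<le> card {..<n - 1}"
      using f by (intro card_inj_on_le[of f]) auto
    then show False using n by simp
  next
    case (2 j)
    \<comment> \<open>No edge has a star colour, while a star with at least one edge has the edge \<open>{0, 1}\<close>.\<close>
    have "contains_copy (colour_class ?K c i) (star_graph (ks ! j))"
      using copy 2 by (simp add: nth_append)
    moreover have "1 \<le> ks ! j" using ks 2 by simp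
    ultimately obtain e where "e \<in> edges (colour_class ?K c i)"
      by (fastforce simp: contains_copy_def star_graph_def)
    then show False
      using 2 by (auto simp: colour_class_def c_def split: if_splits)
  next
    case (3 j)
    let ?F = "{x. x < ?L \<and> p x = j}"
    have copy': "contains_copy (colour_class ?K c i) (matching_graph (ms ! j))"
      using copy 3 by (simp add: nth_append)
    have "ms ! j \<le> card ((+) (n - 1) ` ?F)"
    proof (rule matching_cover_bound[OF copy'])
      fix e assume "e \<in> edges (colour_class ?K c i)"
      then have e: "e \<in> edges ?K" "c e = 1 + ?t + j"
        using 3 by (auto simp: colour_class_def)
      then have "\<not> Max e < n - 1" "p (Max e - (n - 1)) = j"
        by (auto simp: c_def split: if_splits)
      then have "Max e \<in> (+) (n - 1) ` ?F"
        using Max[OF e(1)] N n by (intro image_eqI[of _ _ "Max e - (n - 1)"]) auto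
      then show "e \<inter> (+) (n - 1) ` ?F \<noteq> {}"
        using Max[OF e(1)] by blast
    qed simp
    also have "\<dots> \<le> card ?F" by (rule card_image_le) simp
    also have "\<dots> \<le> ms ! j - 1" using p(2) 3 by simp
    finally show False using ms 3 nth_mem[of j ms] by fastforce
  qed
qed

theorem theorem14:
  shows "\<exists>n1 :: nat \<Rightarrow> nat. \<forall>(ms :: nat list) (ks :: nat list).
    (\<forall>m \<in> set ms. m \<ge> 1) \<longrightarrow> (\<forall>k \<in> set ks. k \<ge> 1) \<longrightarrow>
    (let \<Lambda> = (\<Sum>m\<leftarrow>ms. m - 1); \<Sigma> = (\<Sum>k\<leftarrow>ks. k - 1) in
      \<Sigma> \<le> (\<Lambda> + 1) div 2 \<longrightarrow>
      (\<forall>n > n1 \<Lambda>.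
        ramsey_number (cycle_graph n # map star_graph ks @ map matching_graph ms) = n + \<Lambda>))"
proof -
  have "ramsey_number (cycle_graph n # map star_graph ks @ map matching_graph ms) = n + \<Lambda>"
    if ms: "\<forall>m\<in>set ms. m \<ge> 1" and ks: "\<forall>k\<in>set ks. k \<ge> 1"
      and \<Lambda>: "\<Lambda> = (\<Sum>m\<leftarrow>ms. m - 1)" and le: "(\<Sum>k\<leftarrow>ks. k - 1) \<le> (\<Lambda> + 1) div 2"
      and n: "2 * (1 + 3 * \<Lambda>) * (1 + 3 * \<Lambda>) < n"
    for ms ks :: "nat list" and n \<Lambda> :: nat
  proof -
    let ?d = "1 + (\<Sum>k\<leftarrow>ks. k - 1) + 2 * \<Lambda>"
    have "?d \<le> 1 + 3 * \<Lambda>" using le by linarith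
    then have "2 * ?d * ?d \<le> 2 * (1 + 3 * \<Lambda>) * (1 + 3 * \<Lambda>)"
      by (intro mult_le_mono) auto
    then have "2 * ?d * ?d < n" using n by (rule le_less_trans)
    then have upper: "ramsey_arrows (n + \<Lambda>) (cycle_graph n # map star_graph ks @ map matching_graph ms)"
      unfolding \<Lambda> by (rule ramsey_arrows_cycle_stars_matchings)
    have "n \<ge> 1" using n by simp
    show ?thesis
      unfolding ramsey_number_def
    proof (rule Least_equality)
      show "ramsey_arrows (n + \<Lambda>) (cycle_graph n # map star_graph ks @ map matching_graph ms)"
        by (rule upper)
      fix N assume "ramsey_arrows N (cycle_graph n # map star_graph ks @ map matching_graph ms)"
      then show "n + \<Lambda> \<le> N"
        using not_ramsey_arrows[OF ms ks \<open>n \<ge> 1\<close>] \<Lambda> by (meson not_le)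
    qed
  qed
  then show ?thesis
    by (intro exI[of _ "\<lambda>\<Lambda>. 2 * (1 + 3 * \<Lambda>) * (1 + 3 * \<Lambda>)"]) (simp only: Let_def, blast)
qed

end
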